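(* Let $n\ge 1$ and $A\in\mathbb{C}^{2^n\times 2^n}$. The local $C$-numerical range $W_{\mathrm{loc}}(C,A)$ is rotationally symmetric for all $C\in\mathbb{C}^{2^n\times 2^n}$ if and only if, for all $C\in\mathbb{C}^{2^n\times 2^n}$, $W_{\mathrm{loc}}(C,A)$ is a circular disc in the complex plane centered at the origin.
   Context: $SU_{\mathrm{loc}}(2^n)=SU(2)\otimes\cdots\otimes SU(2)$ ($n$ factors) is the group of all Kronecker products $U_1\otimes\cdots\otimes U_n$ with $U_k\in SU(2)$. For $C,A\in\mathbb{C}^{2^n\times 2^n}$ the local $C$-numerical range is $W_{\mathrm{loc}}(C,A)=\{\mathrm{tr}(C^\dagger UAU^\dagger)\mid U\in SU_{\mathrm{loc}}(2^n)\}\subset\mathbb{C}$. A subset $W\subset\mathbb{C}$ is rotationally symmetric if $e^{i\varphi}W=W$ for all $\varphi\in\mathbb{R}$. A circular disc centered at the origin means a set $\{z\in\mathbb{C}: |z|\le r\}$ with $r\ge 0$ (depending on $C$). *)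

theory Defs
  imports "HOL-Analysis.Analysis"
begin

text \<open>Complex square matrices are represented as functions nat => nat => complex;
  only the entries with both indices below the size N are meaningful.\<close>

type_synonym cmat = "nat \<Rightarrow> nat \<Rightarrow> complex"

definition mmult :: "nat \<Rightarrow> cmat \<Rightarrow> cmat \<Rightarrow> cmat" where
  "mmult N X Y = (\<lambda>i j. \<Sum>k<N. X i k * Y k j)"

definition adj :: "cmat \<Rightarrow> cmat" where
  "adj X = (\<lambda>i j. cnj (X j i))"

definition mtrace :: "nat \<Rightarrow> cmat \<Rightarrow> complex" where
  "mtrace N X = (\<Sum>i<N. X i i)"

definition SU2 :: "cmat \<Rightarrow> bool" where
  "SU2 U \<longleftrightarrow> (\<forall>i<2. \<forall>j<2. mmult 2 (adj U) U i j = (if i = j then 1 else 0))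
              \<and> U 0 0 * U 1 1 - U 0 1 * U 1 0 = 1"

text \<open>Kronecker product U_0 (x) U_1 (x) ... (x) U_{n-1} of 2x2 matrices
  (factor 0 acts on the most significant binary digit of the index).\<close>
definition kron_list :: "nat \<Rightarrow> (nat \<Rightarrow> cmat) \<Rightarrow> cmat" where
  "kron_list n Us = (\<lambda>i j. \<Prod>k<n. Us k ((i div 2 ^ (n - 1 - k)) mod 2)
                                       ((j div 2 ^ (n - 1 - k)) mod 2))"

definition SU_loc :: "nat \<Rightarrow> cmat set" where
  "SU_loc n = {kron_list n Us | Us. \<forall>k<n. SU2 (Us k)}"

definition W_loc :: "nat \<Rightarrow> cmat \<Rightarrow> cmat \<Rightarrow> complex set" where
  "W_loc n C A = {mtrace (2^n) (mmult (2^n) (adj C) (mmult (2^n) (mmult (2^n) U A) (adj U)))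
                  | U. U \<in> SU_loc n}"

definition rot_symmetric :: "complex set \<Rightarrow> bool" where
  "rot_symmetric W \<longleftrightarrow> (\<forall>\<phi>::real. (\<lambda>z. cis \<phi> * z) ` W = W)"

definition centered_disc :: "complex set \<Rightarrow> bool" where
  "centered_disc W \<longleftrightarrow> (\<exists>r::real. r \<ge> 0 \<and> W = cball 0 r)"

end

theory Submission
  imports Defs
begin

text \<open>
  The range is the continuous image of a product of 3-spheres, hence compact and connected;
  if it is rotationally symmetric it is a closed annulus, so it remains to find \<open>0\<close> in it.
  Symmetry for \<open>C = A\<close> and the equality case of Cauchy--Schwarz give a local unitary
  \<open>V\<close> with \<open>V A V\<^sup>* = - A\<close>, so that \<open>f U = tr (C\<^sup>* U A U\<^sup>*)\<close> satisfies
  \<open>f (U V) = - f U\<close> for every \<open>C\<close>. A zero-free such \<open>f\<close> on the compact simply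
  connected group would have a bounded continuous logarithm, yet right multiplication by \<open>V\<close>
  shifts this logarithm by a nonzero constant and can be iterated.
\<close>

subsection \<open>Matrices and Kronecker products\<close>

lemma mmult_assoc: "mmult N (mmult N X Y) Z = mmult N X (mmult N Y Z)"
proof (intro ext)
  fix i j
  have "mmult N (mmult N X Y) Z i j = (\<Sum>k<N. \<Sum>l<N. X i l * Y l k * Z k j)"
    by (simp add: mmult_def sum_distrib_right)
  also have "\<dots> = (\<Sum>l<N. \<Sum>k<N. X i l * Y l k * Z k j)" by (rule sum.swap)
  also have "\<dots> = mmult N X (mmult N Y Z) i j"
    by (simp add: mmult_def sum_distrib_left mult.assoc)
  finally show "mmult N (mmult N X Y) Z i j = mmult N X (mmult N Y Z) i j" .
qed

lemma adj_mmult: "adj (mmult N X Y) = mmult N (adj Y) (adj X)"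
  by (simp add: adj_def mmult_def mult.commute)

lemma adj_adj [simp]: "adj (adj X) = X"
  by (simp add: adj_def)

lemma mtrace_mmult_commute: "mtrace N (mmult N X Y) = mtrace N (mmult N Y X)"
  unfolding mtrace_def mmult_def by (subst sum.swap) (simp add: mult.commute)

lemma mtrace_mmult_cong:
  assumes "\<And>i j. i < N \<Longrightarrow> j < N \<Longrightarrow> Y i j = Y' i j"
  shows "mtrace N (mmult N X Y) = mtrace N (mmult N X Y')"
  using assms by (simp add: mtrace_def mmult_def)

text \<open>Entries with an index at or above \<open>N\<close> are arbitrary, so being the identity
  is a condition on the leading block only, not an equation of matrices.\<close>

definition identity_on :: "nat \<Rightarrow> cmat \<Rightarrow> bool" where
  "identity_on N E \<longleftrightarrow> (\<forall>i<N. \<forall>j<N. E i j = (if i = j then 1 else 0))"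

lemma mmult_identity_left:
  assumes "identity_on N E" "i < N"
  shows "mmult N E X i j = X i j"
proof -
  have "mmult N E X i j = (\<Sum>k<N. if i = k then X k j else 0)"
    unfolding mmult_def using assms by (intro sum.cong) (auto simp: identity_on_def)
  then show ?thesis using assms by simp
qed

lemma mmult_identity_right:
  assumes "identity_on N E" "j < N"
  shows "mmult N X E i j = X i j"
proof -
  have "mmult N X E i j = (\<Sum>k<N. if k = j then X i k else 0)"
    unfolding mmult_def using assms by (intro sum.cong) (auto simp: identity_on_def)
  then show ?thesis using assms by simp
qed

section \<open>The Frobenius inner product under conjugation\<close>

abbreviation conjugate :: "nat \<Rightarrow> cmat \<Rightarrow> cmat \<Rightarrow> cmat" where
  "conjugate N U A \<equiv> mmult N (mmult N U A) (adj U)"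

abbreviation frobenius :: "nat \<Rightarrow> cmat \<Rightarrow> cmat \<Rightarrow> complex" where
  "frobenius N X Y \<equiv> mtrace N (mmult N (adj X) Y)"

lemma frobenius_eq: "frobenius N X Y = (\<Sum>i<N. \<Sum>k<N. cnj (X k i) * Y k i)"
  by (simp add: mtrace_def mmult_def adj_def)

text \<open>Cyclicity of the trace brings the leading \<open>U\<close> to the end; two copies of
  \<open>adj U\<close> times \<open>U\<close> then drop out.\<close>

lemma frobenius_conjugate_self:
  assumes "identity_on N (mmult N (adj U) U)"
  shows "frobenius N (conjugate N U A) (conjugate N U A) = frobenius N A A"
proof -
  let ?E = "mmult N (adj U) U"
  have "frobenius N (conjugate N U A) (conjugate N U A)
      = mtrace N (mmult N U (mmult N (adj A) (mmult N ?E (mmult N A (adj U)))))"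
    by (simp add: adj_mmult mmult_assoc)
  also have "\<dots> = mtrace N (mmult N (adj A) (mmult N (mmult N ?E A) ?E))"
    by (subst mtrace_mmult_commute) (simp add: mmult_assoc)
  also have "\<dots> = frobenius N A A"
    by (rule mtrace_mmult_cong) (simp add: mmult_identity_left mmult_identity_right assms)
  finally show ?thesis .
qed

lemma frobenius_self_eq_0:
  assumes "frobenius N X X = 0" "i < N" "j < N"
  shows "X i j = 0"
proof -
  have eq: "frobenius N X X = of_real (\<Sum>i<N. \<Sum>k<N. (cmod (X k i))\<^sup>2)"
    unfolding frobenius_eq by (simp add: complex_norm_square mult.commute del: of_real_power)
  have 0: "(\<Sum>i<N. \<Sum>k<N. (cmod (X k i))\<^sup>2) = 0"
    using assms(1) unfolding eq using of_real_eq_0_iff by blast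
  have "(\<Sum>k<N. (cmod (X k j))\<^sup>2) = 0"
    using 0 assms by (subst (asm) sum_nonneg_eq_0_iff) (auto intro!: sum_nonneg)
  then have "(cmod (X i j))\<^sup>2 = 0"
    using assms by (subst (asm) sum_nonneg_eq_0_iff) auto
  then show ?thesis by simp
qed

lemma frobenius_commute: "frobenius N Y X = cnj (frobenius N X Y)"
  by (simp add: frobenius_eq mult.commute)

lemma frobenius_add_self:
  "frobenius N (\<lambda>i j. X i j + Y i j) (\<lambda>i j. X i j + Y i j)
    = frobenius N X X + frobenius N X Y + frobenius N Y X + frobenius N Y Y"
  by (simp add: frobenius_eq algebra_simps sum.distrib)

text \<open>Equality case of Cauchy--Schwarz: \<open>A\<close> and its conjugate have the same norm,
  so the squared norm of their sum expands to 0.\<close>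

lemma conjugate_eq_uminus:
  assumes "identity_on N (mmult N (adj U) U)"
    and "frobenius N A (conjugate N U A) = - frobenius N A A"
    and "i < N" "j < N"
  shows "conjugate N U A i j = - A i j"
proof -
  let ?B = "conjugate N U A"
  have self: "cnj (frobenius N A A) = frobenius N A A"
    by (rule frobenius_commute[symmetric])
  have "frobenius N (\<lambda>i j. A i j + ?B i j) (\<lambda>i j. A i j + ?B i j) = 0"
    unfolding frobenius_add_self frobenius_conjugate_self[OF assms(1)]
      frobenius_commute[of N ?B A] assms(2) by (simp add: self)
  from frobenius_self_eq_0[OF this assms(3,4)] show ?thesis
    by (simp add: eq_neg_iff_add_eq_0 add.commute)
qed

text \<open>By cyclicity \<open>conjugate N V A\<close> becomes a single factor of the trace, so its
  sign comes out for every \<open>C\<close> and \<open>U\<close>.\<close>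

lemma frobenius_conjugate_mmult_uminus:
  assumes "\<And>i j. i < N \<Longrightarrow> j < N \<Longrightarrow> conjugate N V A i j = - A i j"
  shows "frobenius N C (conjugate N (mmult N U V) A) = - frobenius N C (conjugate N U A)"
proof -
  have "frobenius N C (conjugate N (mmult N U V) A)
      = mtrace N (mmult N (mmult N (adj C) U) (mmult N (conjugate N V A) (adj U)))"
    by (simp add: adj_mmult mmult_assoc)
  also have "\<dots> = mtrace N (mmult N (mmult N (adj U) (mmult N (adj C) U)) (conjugate N V A))"
    by (subst mtrace_mmult_commute[of N "mmult N (adj U) _"], subst mtrace_mmult_commute)
       (simp add: mmult_assoc)
  also have "\<dots> = mtrace N (mmult N (mmult N (adj U) (mmult N (adj C) U)) (\<lambda>i j. - A i j))"
    by (rule mtrace_mmult_cong) (rule assms)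
  also have "\<dots> = - mtrace N (mmult N (mmult N (adj U) (mmult N (adj C) U)) A)"
    by (simp add: mtrace_def mmult_def sum_negf)
  also have "\<dots> = - frobenius N C (conjugate N U A)"
    by (subst mtrace_mmult_commute[of N _ A], subst mtrace_mmult_commute[of N "adj C"])
       (metis mmult_assoc mtrace_mmult_commute)
  finally show ?thesis .
qed

section \<open>Kronecker products through binary digits\<close>

text \<open>The distributive law, with the indices below \<open>2^n\<close> enumerating all choices
  of digits. Induction splits off the lowest digit.\<close>

lemma sum_prod_binary_digits:
  fixes g :: "nat \<Rightarrow> nat \<Rightarrow> 'a::comm_semiring_1"
  shows "(\<Sum>j<2^n. \<Prod>k<n. g k (j div 2^k mod 2)) = (\<Prod>k<n. g k 0 + g k 1)"
proof (induction n arbitrary: g)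
  case 0
  then show ?case by simp
next
  case (Suc n)
  have two: "{i * 2..<i * 2 + 2} = {i * 2, Suc (i * 2)}" for i :: nat by auto
  have odd: "Suc (i * 2) mod 2 = Suc 0" for i :: nat by presburger
  have "(\<Sum>j<2^Suc n. \<Prod>k<Suc n. g k (j div 2^k mod 2))
      = (\<Sum>i<2^n. \<Sum>j\<in>{i * 2..<i * 2 + 2}. \<Prod>k<Suc n. g k (j div 2^k mod 2))"
    by (subst sum.nat_group) (simp add: mult.commute)
  also have "\<dots> = (\<Sum>i<2^n. (g 0 0 + g 0 1) * (\<Prod>k<n. g (Suc k) (i div 2^k mod 2)))"
    by (intro sum.cong)
       (simp_all add: two odd prod.lessThan_Suc_shift div_mult2_eq algebra_simps
          del: prod.lessThan_Suc)
  also have "\<dots> = (g 0 0 + g 0 1) * (\<Prod>k<n. g (Suc k) 0 + g (Suc k) 1)"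
    by (simp add: sum_distrib_left[symmetric] Suc.IH[of "\<lambda>k. g (Suc k)"])
  also have "\<dots> = (\<Prod>k<Suc n. g k 0 + g k 1)"
    by (simp add: prod.lessThan_Suc_shift del: prod.lessThan_Suc)
  finally show ?case .
qed

text \<open>Lists the factors from the least significant digit on, the order used in
  \<open>sum_prod_binary_digits\<close>.\<close>

lemma kron_list_eq:
  "kron_list n Us i j = (\<Prod>k<n. Us (n - Suc k) (i div 2^k mod 2) (j div 2^k mod 2))"
proof -
  have "kron_list n Us i j = (\<Prod>k<n. (\<lambda>k. Us (n - Suc k) (i div 2^k mod 2) (j div 2^k mod 2)) (n - Suc k))"
    unfolding kron_list_def by (rule prod.cong) (auto simp: Suc_diff_Suc)
  then show ?thesis by (subst (asm) prod.nat_diff_reindex)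
qed

text \<open>Mixed-product rule: for fixed \<open>i\<close> and \<open>j\<close> each summand is a
  product over the digits of the summation index, so the sum of products becomes a product of
  sums.\<close>

lemma mmult_kron_list:
  "mmult (2^n) (kron_list n Us) (kron_list n Vs) = kron_list n (\<lambda>k. mmult 2 (Us k) (Vs k))"
proof (intro ext)
  fix i j
  have two: "{..<2} = {0, 1::nat}" by auto
  show "mmult (2^n) (kron_list n Us) (kron_list n Vs) i j
      = kron_list n (\<lambda>k. mmult 2 (Us k) (Vs k)) i j"
    unfolding mmult_def kron_list_eq prod.distrib[symmetric]
    by (subst sum_prod_binary_digits[where g = "\<lambda>k d. Us (n - Suc k) (i div 2^k mod 2) d * Vs (n - Suc k) d (j div 2^k mod 2)"])
       (simp add: two)
qed

lemma adj_kron_list: "adj (kron_list n Us) = kron_list n (\<lambda>k. adj (Us k))"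
  by (simp add: adj_def kron_list_def)

lemma kron_list_cong:
  assumes "\<And>k i j. k < n \<Longrightarrow> i < 2 \<Longrightarrow> j < 2 \<Longrightarrow> Us k i j = Vs k i j"
  shows "kron_list n Us = kron_list n Vs"
  unfolding kron_list_def using assms by (intro ext prod.cong) auto

text \<open>Distinct indices below \<open>2^n\<close> differ in a digit below \<open>n\<close>, and
  the factor at that digit vanishes.\<close>

lemma identity_on_kron_list:
  assumes "\<And>k. k < n \<Longrightarrow> identity_on 2 (Us k)"
  shows "identity_on (2^n) (kron_list n Us)"
  unfolding identity_on_def
proof (intro allI impI)
  fix i j :: nat assume ij: "i < 2^n" "j < 2^n"
  have eq: "Us (n - Suc k) (i div 2^k mod 2) (j div 2^k mod 2)
      = (if i div 2^k mod 2 = j div 2^k mod 2 then 1 else 0)" if "k < n" for k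
    using assms[of "n - Suc k"] that by (simp add: identity_on_def)
  show "kron_list n Us i j = (if i = j then 1 else 0)"
  proof (cases "i = j")
    case True
    then show ?thesis unfolding kron_list_eq using eq by simp
  next
    case False
    then obtain k where k: "odd (i div 2^k) \<noteq> odd (j div 2^k)"
      by (metis bit_eqI bit_iff_odd)
    have "k < n"
    proof (rule ccontr)
      assume "\<not> k < n"
      then have "(2::nat)^n \<le> 2^k" by simp
      then have "i < 2^k" "j < 2^k" using ij by linarith+
      then show False using k by simp
    qed
    moreover have "i div 2^k mod 2 \<noteq> j div 2^k mod 2" using k by (metis even_iff_mod_2_eq_zero)
    ultimately show ?thesis unfolding kron_list_eq using eq False
      by (auto intro!: prod_zero)
  qed
qed

section \<open>Unit quaternions and SU(2)\<close>

text \<open>A pair \<open>(a, b)\<close> stands for the quaternion \<open>a + j b\<close> and is the first column of its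
  matrix.\<close>
definition su2 :: "complex \<times> complex \<Rightarrow> cmat" where
  "su2 q = (\<lambda>i j. if i = 0 then (if j = 0 then fst q else - cnj (snd q))
                  else (if j = 0 then snd q else cnj (fst q)))"

text \<open>The quaternion product \<open>(a + j b)(c + j d)\<close>, using
  \<open>a j = j (cnj a)\<close>.\<close>

definition qmult :: "complex \<times> complex \<Rightarrow> complex \<times> complex \<Rightarrow> complex \<times> complex" where
  "qmult q r = (fst q * fst r - cnj (snd q) * snd r, snd q * fst r + cnj (fst q) * snd r)"

lemma mem_unit_sphere_iff: "q \<in> sphere 0 1 \<longleftrightarrow> cnj (fst q) * fst q + cnj (snd q) * snd q = 1"
  for q :: "complex \<times> complex"
proof -
  have "cnj (fst q) * fst q + cnj (snd q) * snd q = of_real ((norm q)\<^sup>2)"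
    by (simp add: norm_prod_def complex_norm_square mult.commute del: of_real_power)
  moreover have "complex_of_real ((norm q)\<^sup>2) = 1 \<longleftrightarrow> norm q = 1"
    by (metis norm_ge_zero of_real_1 of_real_eq_iff one_power2 power2_eq_iff_nonneg zero_le_one)
  ultimately show ?thesis by simp
qed

lemma mmult_su2:
  assumes "i < 2" "j < 2"
  shows "mmult 2 (su2 q) (su2 r) i j = su2 (qmult q r) i j"
  using assms by (auto simp: mmult_def su2_def qmult_def numeral_2_eq_2 less_Suc_eq algebra_simps)

lemma SU2_su2:
  assumes "q \<in> sphere 0 1"
  shows "SU2 (su2 q)"
  using assms unfolding SU2_def mem_unit_sphere_iff
  by (auto simp: mmult_def su2_def adj_def numeral_2_eq_2 less_Suc_eq algebra_simps)

text \<open>Orthogonality to the first column and determinant 1 form a linear system for the second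
  column, whose determinant is the squared norm of the first column, hence 1.\<close>

lemma SU2_obtain_su2:
  assumes "SU2 U"
  obtains q where "q \<in> sphere 0 1" "\<And>i j. i < 2 \<Longrightarrow> j < 2 \<Longrightarrow> U i j = su2 q i j"
proof -
  define a b c d where "a = U 0 0" "b = U 1 0" "c = U 0 1" "d = U 1 1"
  have all: "\<forall>i<2. \<forall>j<2. mmult 2 (adj U) U i j = (if i = j then 1 else 0)"
    and det: "a * d - c * b = 1"
    using assms by (auto simp: SU2_def a_b_c_d_def)
  have 1: "cnj a * a + cnj b * b = 1" and 2: "cnj a * c + cnj b * d = 0"
    using all[rule_format, of 0 0] all[rule_format, of 0 1]
    by (simp_all add: mmult_def adj_def numeral_2_eq_2 a_b_c_d_def)
  have "d = cnj a" using 1 2 det by algebra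
  moreover have "c = - cnj b" using 1 2 det by algebra
  ultimately have "U i j = su2 (a, b) i j" if "i < 2" "j < 2" for i j
    using that by (auto simp: su2_def a_b_c_d_def numeral_2_eq_2 less_Suc_eq)
  with 1 show thesis by (intro that[of "(a, b)"]) (simp_all only: mem_unit_sphere_iff fst_conv snd_conv)
qed

subsection \<open>Logarithms along one-parameter subgroups\<close>

text \<open>Tychonoff's theorem; the topology of a function type is the product topology.\<close>

lemma compact_coordinatewise:
  assumes "\<And>k. compact (S k)"
  shows "compact {p. \<forall>k. p k \<in> S k}"
proof -
  have "compactin (product_topology (\<lambda>_. euclidean) UNIV) (PiE UNIV S)"
    using assms by (subst compactin_PiE) simp
  then show ?thesis
    by (simp add: euclidean_product_topology PiE_UNIV_domain Pi_def)
qed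

lemma connected_coordinatewise:
  assumes "\<And>k. connected (S k)"
  shows "connected {p. \<forall>k. p k \<in> S k}"
proof -
  have "connectedin (product_topology (\<lambda>_. euclidean) UNIV) (PiE UNIV S)"
    using assms by (subst connectedin_PiE) simp
  then show ?thesis
    by (simp add: euclidean_product_topology PiE_UNIV_domain Pi_def)
qed

section \<open>Increments of continuous logarithms\<close>

text \<open>Two logarithms of the same number differ by an integer multiple of
  \<open>2 pi \<i>\<close>, so \<open>g\<close> takes values in a discrete set.\<close>

lemma exp_constant_imp_constant_on:
  fixes g :: "'a::topological_space \<Rightarrow> complex"
  assumes "connected S" "continuous_on S g" "\<And>x. x \<in> S \<Longrightarrow> exp (g x) = c"
  shows "g constant_on S"
proof (rule continuous_discrete_range_constant[OF assms(1,2)])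
  fix x assume "x \<in> S"
  have "2 * pi \<le> norm (g y - g x)" if "y \<in> S" "g y \<noteq> g x" for y
  proof -
    have "2 * pi \<le> \<bar>Im (g y) - Im (g x)\<bar>"
      using exp_complex_eqI[of "g y" "g x"] assms(3) \<open>x \<in> S\<close> that by fastforce
    also have "\<dots> \<le> norm (g y - g x)" using abs_Im_le_cmod[of "g y - g x"] by simp
    finally show ?thesis .
  qed
  then show "\<exists>e>0. \<forall>y. y \<in> S \<and> g y \<noteq> g x \<longrightarrow> e \<le> norm (g y - g x)"
    by (intro exI[of _ "2 * pi"]) auto
qed

text \<open>The quotient \<open>exp (g x - g s)\<close> stays in the open unit disc around 1, thus
  in the right half-plane; a larger change of \<open>Im g\<close> would make it purely imaginary at
  some point.\<close>

lemma Im_log_short_step: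
  fixes g :: "real \<Rightarrow> complex"
  assumes "s \<le> s'" "continuous_on {s..s'} g"
    and near: "\<And>x. x \<in> {s..s'} \<Longrightarrow> cmod (exp (g x) - exp (g s)) < cmod (exp (g s))"
  shows "\<bar>Im (g s') - Im (g s)\<bar> \<le> pi / 2"
proof (rule ccontr)
  assume "\<not> ?thesis"
  then have "\<exists>x\<ge>s. x \<le> s' \<and> \<bar>Im (g x) - Im (g s)\<bar> = pi / 2"
    using assms(1,2) by (intro IVT') (auto intro!: continuous_intros)
  then obtain x where x: "x \<in> {s..s'}" "\<bar>Im (g x) - Im (g s)\<bar> = pi / 2" by auto
  have "cos (Im (g x) - Im (g s)) = cos \<bar>Im (g x) - Im (g s)\<bar>" by simp
  then have "Re (exp (g x - g s)) = 0" by (simp add: Re_exp x(2))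
  then have "Re (exp (g x - g s) - 1) = -1" by simp
  then have "1 \<le> cmod (exp (g x - g s) - 1)"
    using abs_Re_le_cmod[of "exp (g x - g s) - 1"] by simp
  moreover have "exp (g x - g s) - 1 = (exp (g x) - exp (g s)) / exp (g s)"
    by (simp add: exp_diff diff_divide_distrib)
  ultimately show False using near[OF x(1)] by (simp add: norm_divide)
qed

text \<open>Compactness makes the bound uniform in \<open>p\<close>: with \<open>|G|\<close> at
  least \<open>\<delta>\<close> and \<open>G\<close> uniformly continuous, a fixed number of short
  steps covers \<open>{a..b}\<close>, each changing \<open>Im g\<close> by at most
  \<open>pi / 2\<close>.\<close>

lemma Im_log_increment_bounded:
  fixes G :: "'a::metric_space \<times> real \<Rightarrow> complex"
  assumes "compact P" "a \<le> b" "continuous_on (P \<times> {a..b}) G"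
    and nz: "\<And>x. x \<in> P \<times> {a..b} \<Longrightarrow> G x \<noteq> 0"
  obtains B where "\<And>p g. p \<in> P \<Longrightarrow> continuous_on {a..b} g \<Longrightarrow>
      (\<And>s. s \<in> {a..b} \<Longrightarrow> G (p, s) = exp (g s)) \<Longrightarrow> \<bar>Im (g b) - Im (g a)\<bar> \<le> B"
proof -
  have cpt: "compact (P \<times> {a..b})" by (intro compact_Times assms(1) compact_Icc)
  have "closed (G ` (P \<times> {a..b}))" "0 \<notin> G ` (P \<times> {a..b})"
    using compact_continuous_image[OF assms(3) cpt] nz by (auto intro: compact_imp_closed)
  then obtain \<delta> where "\<delta> > 0" and \<delta>: "\<And>x. x \<in> P \<times> {a..b} \<Longrightarrow> \<delta> \<le> cmod (G x)"
    using separate_point_closed[of "G ` (P \<times> {a..b})" 0] by auto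
  have "uniformly_continuous_on (P \<times> {a..b}) G"
    by (rule compact_uniformly_continuous[OF assms(3) cpt])
  then obtain \<eta> where "\<eta> > 0" and \<eta>: "\<And>x x'. x \<in> P \<times> {a..b} \<Longrightarrow> x' \<in> P \<times> {a..b} \<Longrightarrow>
      dist x' x < \<eta> \<Longrightarrow> dist (G x') (G x) < \<delta>"
    using \<open>\<delta> > 0\<close> unfolding uniformly_continuous_on_def by metis
  obtain N :: nat where N: "(b - a) / \<eta> < real N" using reals_Archimedean2 by blast
  define N' where "N' = Suc N"
  have N': "N' > 0" "(b - a) / real N' < \<eta>"
  proof -
    have "b - a < real N * \<eta>" using N \<open>\<eta> > 0\<close> by (simp add: field_simps)
    also have "\<dots> \<le> real N' * \<eta>" using \<open>\<eta> > 0\<close> by (simp add: N'_def)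
    finally show "(b - a) / real N' < \<eta>" by (simp add: N'_def field_simps)
  qed (simp add: N'_def)
  define x where "x i = a + real i * ((b - a) / real N')" for i :: nat
  have x_mono: "x i \<le> x j" if "i \<le> j" for i j
    using that assms(2) unfolding x_def by (intro add_left_mono mult_right_mono) simp_all
  have x0: "x 0 = a" and xN: "x N' = b" using N' by (simp_all add: x_def)
  show thesis
  proof (rule that)
    fix p g assume p: "p \<in> P" and g: "continuous_on {a..b} g"
      and log: "\<And>s. s \<in> {a..b} \<Longrightarrow> G (p, s) = exp (g s)"
    have step: "\<bar>Im (g (x (Suc i))) - Im (g (x i))\<bar> \<le> pi / 2" if i: "i < N'" for i
    proof (rule Im_log_short_step)
      show "x i \<le> x (Suc i)" by (simp add: x_mono)
      have ab: "a \<le> x i" "x (Suc i) \<le> b"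
        using x_mono[of 0 i] x_mono[of "Suc i" N'] i x0 xN by auto
      then show "continuous_on {x i..x (Suc i)} g"
        by (intro continuous_on_subset[OF g]) auto
      fix y assume y: "y \<in> {x i..x (Suc i)}"
      have len: "x (Suc i) - x i < \<eta>" using N' unfolding x_def of_nat_Suc distrib_right by simp
      have mem: "(p, y) \<in> P \<times> {a..b}" "(p, x i) \<in> P \<times> {a..b}" using y ab p by auto
      have "dist (p, y) (p, x i) < \<eta>" using y len by (simp add: dist_Pair_Pair dist_real_def)
      from \<eta>[OF mem(2,1) this] \<delta>[OF mem(2)]
      show "cmod (exp (g y) - exp (g (x i))) < cmod (exp (g (x i)))"
        using mem by (simp add: log dist_norm)
    qed
    have "\<bar>Im (g (x i)) - Im (g a)\<bar> \<le> real i * (pi / 2)" if "i \<le> N'" for i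
      using that
    proof (induction i)
      case (Suc i)
      have "real (Suc i) * (pi / 2) = real i * (pi / 2) + pi / 2" by (simp add: distrib_right)
      with Suc step[of i] show ?case by linarith
    qed (simp add: x0)
    from this[of N'] show "\<bar>Im (g b) - Im (g a)\<bar> \<le> real N' * (pi / 2)" by (simp add: xN)
  qed
qed

section \<open>Great circles and the existence of a zero\<close>

text \<open>A great circle that moves \<open>x\<close> to \<open>w\<close> as \<open>s\<close> runs
  from 0 to \<open>pi / 2\<close>; it provides the contraction to a constant.\<close>

lemma norm_cos_sin_combination:
  fixes x w :: "'a::real_inner"
  assumes "x \<in> sphere 0 1" "w \<in> sphere 0 1" "x \<bullet> w = 0"
  shows "cos s *\<^sub>R x + sin s *\<^sub>R w \<in> sphere 0 1"
proof -
  have "x \<bullet> x = 1" "w \<bullet> w = 1" using assms by (simp_all add: dot_square_norm)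
  then have "(cos s *\<^sub>R x + sin s *\<^sub>R w) \<bullet> (cos s *\<^sub>R x + sin s *\<^sub>R w) = (cos s)\<^sup>2 + (sin s)\<^sup>2"
    using assms(3) by (simp add: inner_add inner_commute power2_eq_square)
  then show ?thesis by (simp add: norm_eq_sqrt_inner)
qed

text \<open>The one-parameter subgroup \<open>\<gamma>\<close> is a great circle of the 3-sphere, which leaves room for
  a unit vector \<open>w\<close> orthogonal to all of it.\<close>
lemma one_parameter_subgroup:
  fixes v :: "complex \<times> complex"
  assumes "v \<in> sphere 0 1"
  obtains \<gamma> w where "continuous_on UNIV \<gamma>" "w \<in> sphere 0 1" "\<And>t::real. \<gamma> t \<in> sphere 0 1"
    "\<And>t. \<gamma> t \<bullet> w = 0" "\<And>t. \<gamma> (t + 1) = qmult (\<gamma> t) v"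
proof -
  obtain a b where v: "v = (a, b)" by force
  define r where "r = sqrt ((Im a)\<^sup>2 + (cmod b)\<^sup>2)"
  have "(norm v)\<^sup>2 = 1" using assms by simp
  then have "(Re a)\<^sup>2 + (Im a)\<^sup>2 + (cmod b)\<^sup>2 = 1"
    by (simp add: v norm_prod_def cmod_power2)
  then have "(Re a)\<^sup>2 + r\<^sup>2 = 1" "0 \<le> r" by (simp_all add: r_def)
  then obtain \<theta> where \<theta>: "Re a = cos \<theta>" "r = sin \<theta>"
    using sincos_total_pi by metis
  \<comment> \<open>The imaginary part of the quaternion \<open>v\<close> is written as
    \<open>r\<close> times a unit vector \<open>(y, d)\<close>; for \<open>r = 0\<close> any unit
    vector serves.\<close>
  have "\<exists>y d. Im a = r * y \<and> b = of_real r * d \<and> y\<^sup>2 + (cmod d)\<^sup>2 = 1"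
  proof (cases "r = 0")
    case True
    then have "(Im a)\<^sup>2 + (cmod b)\<^sup>2 = 0" by (simp add: r_def)
    then have "Im a = 0 \<and> b = 0" by (simp add: add_nonneg_eq_0_iff)
    then show ?thesis using True by (intro exI[of _ 1] exI[of _ 0]) simp
  next
    case False
    have "(Im a / r)\<^sup>2 + (cmod (b / of_real r))\<^sup>2 = ((Im a)\<^sup>2 + (cmod b)\<^sup>2) / r\<^sup>2"
      by (simp add: norm_divide power_divide add_divide_distrib)
    also have "\<dots> = 1" using False by (simp add: r_def)
    finally show ?thesis using False
      by (intro exI[of _ "Im a / r"] exI[of _ "b / of_real r"]) simp
  qed
  then obtain y d where yd: "Im a = r * y" "b = of_real r * d" "y\<^sup>2 + (cmod d)\<^sup>2 = 1" by blast
  have yd': "y\<^sup>2 + (Re d)\<^sup>2 + (Im d)\<^sup>2 = 1" using yd(3) by (simp add: cmod_power2)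
  \<comment> \<open>With the imaginary unit quaternion \<open>u = \<i> y + j d\<close>, this is
    \<open>exp (\<theta> t u) = cos (\<theta> t) + sin (\<theta> t) u\<close>, and
    \<open>\<gamma> 1 = v\<close>.\<close>
  define \<gamma> where "\<gamma> t = (of_real (cos (\<theta> * t)) + \<i> * of_real (y * sin (\<theta> * t)),
      of_real (sin (\<theta> * t)) * d)" for t
  \<comment> \<open>Orthogonal to both 1 and \<open>u\<close>, which span the plane of
    \<open>\<gamma>\<close>: multiplication by \<open>\<i>\<close> turns \<open>d\<close> by a right
    angle.\<close>
  define w where "w = (0 :: complex, if d = 0 then 1 else \<i> * d / of_real (cmod d))"
  show thesis
  proof (rule that)
    show "continuous_on UNIV \<gamma>" unfolding \<gamma>_def by (intro continuous_intros)
    show "w \<in> sphere 0 1" by (auto simp: w_def norm_prod_def norm_mult norm_divide)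
    show "\<gamma> t \<bullet> w = 0" for t by (auto simp: \<gamma>_def w_def inner_prod_def inner_complex_def)
    show "\<gamma> t \<in> sphere 0 1" for t
    proof -
      have "(norm (\<gamma> t))\<^sup>2 = (cos (\<theta> * t))\<^sup>2 + (sin (\<theta> * t))\<^sup>2 * (y\<^sup>2 + (cmod d)\<^sup>2)"
        by (simp add: \<gamma>_def norm_prod_def cmod_power2 norm_mult power_mult_distrib algebra_simps)
      also have "\<dots> = 1" by (simp add: yd(3))
      finally have "norm (\<gamma> t) = 1" by (simp add: power2_eq_1_iff) (metis norm_ge_zero not_one_le_zero neg_0_le_iff_le)
      then show ?thesis by simp
    qed
    show "\<gamma> (t + 1) = qmult (\<gamma> t) v" for t
    proof -
      have a: "a = Complex (cos \<theta>) (sin \<theta> * y)" using \<theta> yd by (simp add: complex_eq_iff)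
      have b: "b = of_real (sin \<theta>) * d" using \<theta> yd by simp
      have sq: "y * y = 1 - Re d * Re d - Im d * Im d" using yd' by (simp add: power2_eq_square)
      \<comment> \<open>The identity \<open>y^2 + |d|^2 = 1\<close> multiplied by \<open>z\<close>,
        in the form in which the expanded quaternion product contains it.\<close>
      have key: "y * (y * z) + (Im d * (Im d * z) + Re d * (Re d * z)) = z" for z
        using arg_cong[OF sq, of "\<lambda>u. u * z"] by (simp add: algebra_simps)
      show ?thesis
        by (simp add: \<gamma>_def qmult_def v a b complex_eq_iff distrib_left cos_add sin_add algebra_simps key)
    qed
  qed
qed

text \<open>If \<open>f\<close> had no zero, choose one-parameter subgroups \<open>\<gamma> k\<close> through the \<open>v k\<close>. The
  logarithm of \<open>f \<circ> \<gamma>\<close> moves by a fixed odd multiple of \<open>\<pi>\<i>\<close> in each unit of time.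
  But \<open>\<gamma>\<close> contracts to a constant \<open>w\<close> along great circles, and along these the
  logarithm changes by a bounded amount.\<close>
lemma zero_of_translation_anti_invariant:
  fixes f :: "(nat \<Rightarrow> complex \<times> complex) \<Rightarrow> complex"
  defines "D \<equiv> {p. \<forall>k. p k \<in> sphere 0 1}"
  assumes f: "continuous_on D f" and "v \<in> D"
    and anti: "\<And>p. p \<in> D \<Longrightarrow> f (\<lambda>k. qmult (p k) (v k)) = - f p"
  shows "\<exists>p\<in>D. f p = 0"
proof (rule ccontr)
  assume "\<not> ?thesis"
  then have nz: "f p \<noteq> 0" if "p \<in> D" for p using that by blast
  have "\<exists>\<gamma> w. continuous_on UNIV \<gamma> \<and> w \<in> sphere 0 1 \<and> (\<forall>t::real. \<gamma> t \<in> sphere 0 1) \<and>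
      (\<forall>t. \<gamma> t \<bullet> w = 0) \<and> (\<forall>t. \<gamma> (t + 1) = qmult (\<gamma> t) (v k))" for k
  proof -
    have "v k \<in> sphere 0 1" using \<open>v \<in> D\<close> by (simp add: D_def)
    then show ?thesis by (rule one_parameter_subgroup) blast
  qed
  then obtain \<gamma> w where \<gamma>: "\<And>k. continuous_on UNIV (\<gamma> k)" and w: "\<And>k. w k \<in> sphere 0 1"
    and \<gamma>_sphere: "\<And>k t::real. \<gamma> k t \<in> sphere 0 1" and orth: "\<And>k t. \<gamma> k t \<bullet> w k = 0"
    and shift: "\<And>k t. \<gamma> k (t + 1) = qmult (\<gamma> k t) (v k)"
    by metis
  \<comment> \<open>Slides each coordinate along its great circle from \<open>p k\<close> to
    \<open>w k\<close>.\<close>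
  define \<Phi> where "\<Phi> p s k = cos s *\<^sub>R p k + sin s *\<^sub>R w k" for p s k
  have \<Phi>_0: "\<Phi> p 0 = p" and \<Phi>_half: "\<Phi> p (pi/2) = w" for p
    by (simp_all add: \<Phi>_def fun_eq_iff)
  \<comment> \<open>All of \<open>\<gamma>\<close> lies in this compact set, so one bound
    \<open>B\<close> serves for every time \<open>t\<close>.\<close>
  define P where "P = {p. \<forall>k. p k \<in> {x \<in> sphere 0 1. x \<bullet> w k = 0}}"
  have \<Phi>_D: "\<Phi> p s \<in> D" if "p \<in> P" for p s
    using that w norm_cos_sin_combination unfolding P_def D_def \<Phi>_def by blast
  have \<gamma>_P: "(\<lambda>k. \<gamma> k t) \<in> P" for t
    using \<gamma>_sphere orth by (auto simp: P_def)
  have "compact {x \<in> sphere 0 1. x \<bullet> w k = 0}" for k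
  proof -
    have "compact (sphere 0 1 \<inter> {x. w k \<bullet> x = 0})"
      by (intro compact_Int_closed compact_sphere closed_hyperplane)
    then show ?thesis by (simp add: Int_def inner_commute)
  qed
  then have "compact P" unfolding P_def by (rule compact_coordinatewise)
  have "continuous_on (P \<times> {0..pi/2}) (\<lambda>x. f (\<Phi> (fst x) (snd x)))"
  proof (rule continuous_on_compose2[OF f])
    have "continuous_on (P \<times> {0..pi/2}) (\<lambda>x. fst x k)" for k
      by (rule continuous_on_compose2[OF continuous_on_product_coordinates[of k]])
         (auto intro: continuous_intros)
    then show "continuous_on (P \<times> {0..pi/2}) (\<lambda>x. \<Phi> (fst x) (snd x))"
      unfolding \<Phi>_def by (intro continuous_intros)
  qed (auto simp: \<Phi>_D)
  then obtain B where B: "\<And>p g. p \<in> P \<Longrightarrow> continuous_on {0..pi/2} g \<Longrightarrow>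
      (\<And>s. s \<in> {0..pi/2} \<Longrightarrow> f (\<Phi> p s) = exp (g s)) \<Longrightarrow> \<bar>Im (g (pi/2)) - Im (g 0)\<bar> \<le> B"
    by (rule Im_log_increment_bounded[OF \<open>compact P\<close>, rotated]) (auto simp: nz \<Phi>_D)

  \<comment> \<open>\<open>F\<close> lives on the whole plane, which is contractible, and has no
    zero since \<open>\<Phi>\<close> stays in \<open>D\<close>; hence the continuous logarithm
    \<open>h\<close>.\<close>
  define F where "F x = f (\<Phi> (\<lambda>k. \<gamma> k (fst x)) (snd x))" for x
  have "continuous_on UNIV F"
    unfolding F_def
  proof (rule continuous_on_compose2[OF f])
    show "continuous_on UNIV (\<lambda>x. \<Phi> (\<lambda>k. \<gamma> k (fst x)) (snd x))"
      unfolding \<Phi>_def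
      by (intro continuous_intros continuous_on_compose2[OF \<gamma>]) auto
  qed (auto simp: \<Phi>_D \<gamma>_P)
  then obtain h where h: "continuous_on UNIV h" and F_exp: "\<And>x. F x = exp (h x)"
    by (rule continuous_logarithm_on_contractible)
       (auto simp: F_def nz \<Phi>_D \<gamma>_P convex_imp_contractible)

  \<comment> \<open>At \<open>s = pi / 2\<close> all paths have arrived at \<open>w\<close>, so
    \<open>F\<close> no longer depends on \<open>t\<close> there.\<close>
  have "(\<lambda>t. h (t, pi/2)) constant_on UNIV"
  proof (rule exp_constant_imp_constant_on)
    show "continuous_on UNIV (\<lambda>t. h (t, pi/2))"
      by (intro continuous_on_compose2[OF h] continuous_intros) auto
    show "exp (h (t, pi/2)) = f w" for t by (simp add: F_exp[symmetric] F_def \<Phi>_half)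
  qed simp
  then obtain c where c: "\<And>t. h (t, pi/2) = c" by (auto simp: constant_on_def)
  have exp_step: "exp (h (t + 1, 0) - h (t, 0)) = - 1" for t
  proof -
    have "F (t + 1, 0) = f (\<lambda>k. qmult (\<gamma> k t) (v k))" by (simp add: F_def \<Phi>_0 shift)
    also have "\<dots> = - F (t, 0)"
      using \<gamma>_sphere by (subst anti) (simp_all add: F_def \<Phi>_0 D_def)
    finally show ?thesis by (simp add: exp_diff F_exp)
  qed
  have "(\<lambda>t. h (t + 1, 0) - h (t, 0)) constant_on UNIV"
  proof (rule exp_constant_imp_constant_on)
    show "continuous_on UNIV (\<lambda>t. h (t + 1, 0) - h (t, 0))"
      by (intro continuous_on_compose2[OF h] continuous_intros) auto
  qed (use exp_step in auto)
  then obtain e where e: "\<And>t. h (t + 1, 0) - h (t, 0) = e" by (auto simp: constant_on_def)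
  have "Im e \<noteq> 0"
  proof
    assume "Im e = 0"
    then have "Re (exp e) > 0" by (simp add: Re_exp)
    moreover have "exp e = - 1" using exp_step e by metis
    ultimately show False by simp
  qed
  have iter: "Im (h (real m, 0)) = Im (h (0, 0)) + real m * Im e" for m :: nat
  proof (induction m)
    case (Suc m)
    have "Im (h (real m + 1, 0)) - Im (h (real m, 0)) = Im e"
      using arg_cong[OF e[of "real m"], of Im] by simp
    with Suc show ?case by (simp add: algebra_simps)
  qed simp
  have bound: "\<bar>Im c - Im (h (t, 0))\<bar> \<le> B" for t
  proof -
    have "\<bar>Im (h (t, pi/2)) - Im (h (t, 0))\<bar> \<le> B"
    proof (rule B[OF \<gamma>_P])
      show "continuous_on {0..pi/2} (\<lambda>s. h (t, s))"
        by (intro continuous_on_compose2[OF h] continuous_intros) auto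
      show "f (\<Phi> (\<lambda>k. \<gamma> k t) s) = exp (h (t, s))" for s by (simp add: F_exp[symmetric] F_def)
    qed
    then show ?thesis by (simp add: c)
  qed
  \<comment> \<open>\<open>Im (h (0, 0))\<close> and \<open>Im (h (m, 0))\<close> both lie within
    \<open>B\<close> of \<open>Im c\<close> but differ by \<open>m * Im e\<close>, which fails for
    large \<open>m\<close>.\<close>
  obtain m :: nat where m: "2 * B / \<bar>Im e\<bar> < real m" using reals_Archimedean2 by blast
  then have "2 * B < real m * \<bar>Im e\<bar>" using \<open>Im e \<noteq> 0\<close> by (simp add: field_simps)
  also have "\<dots> = \<bar>real m * Im e\<bar>" by (simp add: abs_mult)
  also have "\<dots> \<le> 2 * B" using bound[of "real m"] bound[of 0] iter[of m] by linarith
  finally show False by simp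
qed

subsection \<open>The local numerical range\<close>

text \<open>Parameters are sequences of quaternions, read only below \<open>n\<close>, so that the
  topology of the function type applies.\<close>

definition local_value :: "nat \<Rightarrow> cmat \<Rightarrow> cmat \<Rightarrow> (nat \<Rightarrow> complex \<times> complex) \<Rightarrow> complex" where
  "local_value n C A p = frobenius (2^n) C (conjugate (2^n) (kron_list n (\<lambda>k. su2 (p k))) A)"

lemma W_loc_eq_image: "W_loc n C A = local_value n C A ` {p. \<forall>k. p k \<in> sphere 0 1}"
proof (intro equalityI subsetI)
  fix z assume "z \<in> W_loc n C A"
  then obtain Us where SU: "\<forall>k<n. SU2 (Us k)"
    and z: "z = frobenius (2^n) C (conjugate (2^n) (kron_list n Us) A)"
    by (auto simp: W_loc_def SU_loc_def)
  have "\<forall>k. \<exists>q. q \<in> sphere 0 1 \<and> (k < n \<longrightarrow> (\<forall>i<2. \<forall>j<2. Us k i j = su2 q i j))"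
  proof
    fix k
    show "\<exists>q. q \<in> sphere 0 1 \<and> (k < n \<longrightarrow> (\<forall>i<2. \<forall>j<2. Us k i j = su2 q i j))"
    proof (cases "k < n")
      case True
      then show ?thesis using SU SU2_obtain_su2 by metis
    next
      case False
      \<comment> \<open>Coordinates from \<open>n\<close> on are filled with the quaternion
        1.\<close>
      then show ?thesis by (intro exI[of _ "(1, 0)"]) simp
    qed
  qed
  then obtain p where p: "\<And>k. p k \<in> sphere 0 1"
    "\<And>k i j. k < n \<Longrightarrow> i < 2 \<Longrightarrow> j < 2 \<Longrightarrow> Us k i j = su2 (p k) i j" by metis
  have "kron_list n Us = kron_list n (\<lambda>k. su2 (p k))" by (rule kron_list_cong) (rule p(2))
  then show "z \<in> local_value n C A ` {p. \<forall>k. p k \<in> sphere 0 1}"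
    using p(1) by (auto simp: z local_value_def)
next
  fix z assume "z \<in> local_value n C A ` {p. \<forall>k. p k \<in> sphere 0 1}"
  then show "z \<in> W_loc n C A"
    using SU2_su2 unfolding W_loc_def SU_loc_def local_value_def by blast
qed

lemma continuous_on_local_value: "continuous_on S (local_value n C A)"
proof -
  have "continuous_on S (\<lambda>p. su2 (p k) i j)" for k i j
  proof -
    have "continuous_on S (\<lambda>p. p k)"
      by (rule continuous_on_subset[OF continuous_on_product_coordinates]) simp
    then show ?thesis
      by (cases "i = 0"; cases "j = 0") (simp_all add: su2_def continuous_intros)
  qed
  then show ?thesis
    unfolding local_value_def mtrace_def mmult_def adj_def kron_list_def
    by (intro continuous_intros)
qed

lemma compact_W_loc: "compact (W_loc n C A)"
  unfolding W_loc_eq_image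
  by (intro compact_continuous_image continuous_on_local_value compact_coordinatewise compact_sphere)

lemma connected_W_loc: "connected (W_loc n C A)"
  unfolding W_loc_eq_image
  by (intro connected_continuous_image continuous_on_local_value connected_coordinatewise
      connected_sphere) simp

lemma identity_on_adj_kron_su2:
  assumes "\<And>k. p k \<in> sphere 0 1"
  shows "identity_on (2^n) (mmult (2^n) (adj (kron_list n (\<lambda>k. su2 (p k)))) (kron_list n (\<lambda>k. su2 (p k))))"
  unfolding adj_kron_list mmult_kron_list
  by (rule identity_on_kron_list) (use SU2_su2[OF assms] in \<open>simp add: SU2_def identity_on_def\<close>)

lemma local_value_one: "local_value n C A (\<lambda>_. (1, 0)) = frobenius (2^n) C A"
proof -
  have I: "identity_on (2^n) (kron_list n (\<lambda>_. su2 (1, 0)))"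
    by (rule identity_on_kron_list) (auto simp: identity_on_def su2_def)
  then have "identity_on (2^n) (adj (kron_list n (\<lambda>_. su2 (1, 0))))"
    by (auto simp: identity_on_def adj_def)
  with I show ?thesis
    unfolding local_value_def
    by (intro mtrace_mmult_cong) (simp add: mmult_identity_left mmult_identity_right)
qed

text \<open>Symmetry for \<open>C = A\<close> alone supplies a \<open>v\<close> that negates
  \<open>A\<close>; this \<open>v\<close> then serves every \<open>C\<close>.\<close>

lemma zero_mem_W_loc:
  assumes "rot_symmetric (W_loc n A A)"
  shows "0 \<in> W_loc n C A"
proof -
  let ?D = "{p. \<forall>k. p k \<in> sphere 0 (1::real)} :: (nat \<Rightarrow> complex \<times> complex) set"
  let ?K = "\<lambda>p. kron_list n (\<lambda>k. su2 (p k))"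
  have "(\<lambda>_. (1, 0)) \<in> ?D" by simp
  then have "frobenius (2^n) A A \<in> W_loc n A A"
    unfolding W_loc_eq_image local_value_one[symmetric] by (rule imageI)
  \<comment> \<open>Rotation by \<open>pi\<close> reaches the negative of the squared norm, the
    extreme value that \<open>conjugate_eq_uminus\<close> requires.\<close>
  then have "cis pi * frobenius (2^n) A A \<in> W_loc n A A"
    using assms unfolding rot_symmetric_def by blast
  then obtain v where v: "v \<in> ?D"
    and eq: "frobenius (2^n) A (conjugate (2^n) (?K v) A) = - frobenius (2^n) A A"
    by (auto simp: W_loc_eq_image local_value_def)
  have neg: "conjugate (2^n) (?K v) A i j = - A i j" if "i < 2^n" "j < 2^n" for i j
    using v by (intro conjugate_eq_uminus[OF identity_on_adj_kron_su2 eq that]) simp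
  have "\<exists>p\<in>?D. local_value n C A p = 0"
  proof (rule zero_of_translation_anti_invariant[OF continuous_on_local_value v])
    fix p
    have "?K (\<lambda>k. qmult (p k) (v k)) = mmult (2^n) (?K p) (?K v)"
      unfolding mmult_kron_list by (rule kron_list_cong) (simp add: mmult_su2)
    then show "local_value n C A (\<lambda>k. qmult (p k) (v k)) = - local_value n C A p"
      unfolding local_value_def by (simp add: frobenius_conjugate_mmult_uminus neg)
  qed
  then show ?thesis unfolding W_loc_eq_image by force
qed

section \<open>Rotationally symmetric sets and discs\<close>

text \<open>By connectedness the moduli of points of \<open>W\<close> fill the interval from 0 to
  their maximum, and rotation sweeps out each full circle.\<close>

lemma rot_symmetric_imp_centered_disc:
  assumes "rot_symmetric W" "compact W" "connected W" "0 \<in> W"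
  shows "centered_disc W"
proof -
  have "compact (norm ` W)"
    by (intro compact_continuous_image continuous_intros assms(2))
  moreover have "norm ` W \<noteq> {}" using assms(4) by blast
  ultimately obtain z where z: "z \<in> W" "\<And>y. y \<in> W \<Longrightarrow> norm y \<le> norm z"
    using compact_attains_sup[of "norm ` W"] by auto
  have "cball 0 (norm z) \<subseteq> W"
  proof
    fix y :: complex assume "y \<in> cball 0 (norm z)"
    then have "norm y \<in> {norm (0::complex)..norm z}" by simp
    moreover have "connected (norm ` W)"
      by (intro connected_continuous_image continuous_intros assms(3))
    ultimately have "norm y \<in> norm ` W"
      using z(1) assms(4) connected_contains_Icc[of "norm ` W" "norm 0" "norm z"] by blast
    then obtain x where x: "x \<in> W" "norm y = norm x" by auto
    have "y = cis (Arg y - Arg x) * x"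
      by (metis rcis_cmod_Arg rcis_def x(2) cis_mult mult.left_commute diff_add_cancel)
    then show "y \<in> W" using assms(1) x(1) unfolding rot_symmetric_def by blast
  qed
  with z have "W = cball 0 (norm z)" by auto
  then show ?thesis unfolding centered_disc_def by (metis norm_ge_zero)
qed

lemma rot_symmetric_cball: "rot_symmetric (cball 0 r)"
  unfolding rot_symmetric_def
proof
  fix \<phi>
  have "z \<in> (\<lambda>z. cis \<phi> * z) ` cball 0 r" if "z \<in> cball 0 r" for z :: complex
    using that
    by (intro image_eqI[of _ _ "cis (- \<phi>) * z"]) (simp_all add: norm_mult mult.assoc[symmetric] cis_mult)
  then show "(\<lambda>z. cis \<phi> * z) ` cball 0 r = cball 0 r" by (auto simp: norm_mult)
qed

theorem theorem3p5:
  fixes n :: nat and A :: cmat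
  assumes "n \<ge> 1"
  shows "(\<forall>C::cmat. rot_symmetric (W_loc n C A)) \<longleftrightarrow> (\<forall>C::cmat. centered_disc (W_loc n C A))"
proof
  assume "\<forall>C. rot_symmetric (W_loc n C A)"
  then show "\<forall>C. centered_disc (W_loc n C A)"
    by (simp add: rot_symmetric_imp_centered_disc compact_W_loc connected_W_loc zero_mem_W_loc)
next
  assume "\<forall>C. centered_disc (W_loc n C A)"
  then show "\<forall>C. rot_symmetric (W_loc n C A)"
    unfolding centered_disc_def using rot_symmetric_cball by metis
qed

end
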